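(* (1) Let $\{(X_n,d_n):n\in\omega\}$ be a family of metric spaces. If $\Delta((X_n,d_n)_n)$ holds, then $\nabla_nX_n$ is monotonically normal. (2) Let $\{X_n:n\in\omega\}$ be a family of metrizable spaces. If $\nabla_nX_n$ is monotonically normal, then $\Delta((X_n,d_n)_n)$ holds for any choice of compatible metrics $d_n$ for $X_n$.
   Context: $\square_nX_n$ is $\prod_nX_n$ with base all $\prod_nU_n$, $U_n$ open in $X_n$; $x\sim y$ iff $\{n:x(n)\neq y(n)\}$ is finite; $\nabla_nX_n=\square_nX_n/\sim$ with the quotient topology. Elements of $\nabla_nX_n$ are denoted by representatives; the notions below do not depend on them. For $a\in X_n$ and $\varepsilon>0$, $B_n(a,\varepsilon)$ is $\{a\}$ if $a$ is isolated in $X_n$, and otherwise the $\varepsilon$-ball about $a$ in the metric $d_n$. For $x,y\in\nabla_nX_n$ and $f\in\omega^\omega$, $M(x,f;y)=\{n\in\omega: y(n)\notin B_n(x(n),1/f(n))\}$. Convention: $1/0=\infty$ (equivalently one may restrict to functions $f$ with positive values). $(x,f),(y,g)\in\nabla_nX_n\times\omega^\omega$ switch if $M(x,f;y)$ and $M(y,g;x)$ are almost disjoint infinite sets (both infinite, with finite intersection). $\Delta((X_n,d_n)_n)$ is the statement: there is $F:\nabla_nX_n\times\omega^\omega\to\omega^\omega$, writing $f_x:=F(x,f)$, such that if $(x,f),(y,g)$ switch, then $1/f_x(n)+1/g_y(n)<d_n(x(n),y(n))$ for infinitely many $n\in\omega$. A space is monotonically normal if to every point $x$ and open $U\ni x$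 there is assigned an open $G(x,U)$ with $x\in G(x,U)\subseteq U$ such that $G(x,U)\cap G(y,V)\neq\emptyset$ implies $x\in V$ or $y\in U$. *)

theory Defs
  imports "HOL-Analysis.Analysis"
begin

text \<open>A countable family of spaces is a function on \<^typ>\<open>nat\<close> with values in topologies (or metrics) on
  subsets of one common type; the carriers are arbitrary, possibly different, subsets.\<close>

definition box_topology :: "(nat \<Rightarrow> 'a topology) \<Rightarrow> (nat \<Rightarrow> 'a) topology" where
  "box_topology X =
     topology (arbitrary union_of (\<lambda>W. \<exists>U. (\<forall>n. openin (X n) (U n)) \<and> W = Pi\<^sub>E UNIV U))"

lemma openin_box_topology:
  "openin (box_topology X) =
     arbitrary union_of (\<lambda>W. \<exists>U. (\<forall>n. openin (X n) (U n)) \<and> W = Pi\<^sub>E UNIV U)"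
proof -
  have "istopology (arbitrary union_of (\<lambda>W. \<exists>U. (\<forall>n. openin (X n) (U n)) \<and> W = Pi\<^sub>E UNIV U))"
  proof (rule istopology_base)
    fix S T
    assume "\<exists>U. (\<forall>n. openin (X n) (U n)) \<and> S = Pi\<^sub>E UNIV U"
      and "\<exists>U. (\<forall>n. openin (X n) (U n)) \<and> T = Pi\<^sub>E UNIV U"
    then obtain U V where "\<forall>n. openin (X n) (U n)" "S = Pi\<^sub>E UNIV U"
      "\<forall>n. openin (X n) (V n)" "T = Pi\<^sub>E UNIV V" by blast
    then have "(\<forall>n. openin (X n) (U n \<inter> V n)) \<and> S \<inter> T = Pi\<^sub>E UNIV (\<lambda>n. U n \<inter> V n)"
      by (auto simp: PiE_Int)
    then show "\<exists>U. (\<forall>n. openin (X n) (U n)) \<and> S \<inter> T = Pi\<^sub>E UNIV U"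
      by (intro exI[of _ "\<lambda>n. U n \<inter> V n"])
  qed
  then show ?thesis
    by (simp add: box_topology_def topology_inverse')
qed

lemma topspace_box_topology [simp]:
  "topspace (box_topology X) = Pi\<^sub>E UNIV (\<lambda>n. topspace (X n))"
proof
  show "topspace (box_topology X) \<subseteq> Pi\<^sub>E UNIV (\<lambda>n. topspace (X n))"
  proof
    fix x assume "x \<in> topspace (box_topology X)"
    then obtain W where "openin (box_topology X) W" "x \<in> W" by (auto simp: topspace_def)
    then obtain U where "\<forall>n. openin (X n) (U n)" "x \<in> Pi\<^sub>E UNIV U"
      by (auto simp: openin_box_topology union_of_def)
    then show "x \<in> Pi\<^sub>E UNIV (\<lambda>n. topspace (X n))"
      using openin_subset by (fastforce simp: PiE_iff)
  qed
  have "openin (box_topology X) (Pi\<^sub>E UNIV (\<lambda>n. topspace (X n)))"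
    unfolding openin_box_topology by (rule arbitrary_union_of_inc) auto
  then show "Pi\<^sub>E UNIV (\<lambda>n. topspace (X n)) \<subseteq> topspace (box_topology X)"
    by (rule openin_subset)
qed

definition eq_mod_finite :: "(nat \<Rightarrow> 'a set) \<Rightarrow> ((nat \<Rightarrow> 'a) \<times> (nat \<Rightarrow> 'a)) set" where
  "eq_mod_finite A =
     {(x, y). x \<in> Pi\<^sub>E UNIV A \<and> y \<in> Pi\<^sub>E UNIV A \<and> finite {n. x n \<noteq> y n}}"

lemma equiv_eq_mod_finite: "equiv (Pi\<^sub>E UNIV A) (eq_mod_finite A)"
proof (rule equivI)
  show "trans (eq_mod_finite A)"
  proof (rule transI)
    fix x y z assume *: "(x, y) \<in> eq_mod_finite A" "(y, z) \<in> eq_mod_finite A"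
    have "{n. x n \<noteq> z n} \<subseteq> {n. x n \<noteq> y n} \<union> {n. y n \<noteq> z n}" by auto
    with * show "(x, z) \<in> eq_mod_finite A"
      by (auto simp: eq_mod_finite_def intro: finite_subset)
  qed
  show "sym (eq_mod_finite A)"
  proof (rule symI)
    fix x y assume "(x, y) \<in> eq_mod_finite A"
    moreover have "{n. y n \<noteq> x n} = {n. x n \<noteq> y n}" by auto
    ultimately show "(y, x) \<in> eq_mod_finite A" by (simp add: eq_mod_finite_def)
  qed
qed (auto simp: eq_mod_finite_def refl_on_def)

text \<open>The points of the nabla product are equivalence classes. A set of classes is open iff its
  preimage under the quotient map, which is its union, is open in the box product.\<close>

definition nabla :: "(nat \<Rightarrow> 'a topology) \<Rightarrow> (nat \<Rightarrow> 'a) set topology" where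
  "nabla X = topology (\<lambda>W.
     W \<subseteq> topspace (box_topology X) // eq_mod_finite (\<lambda>n. topspace (X n))
     \<and> openin (box_topology X) (\<Union>W))"

lemma openin_nabla:
  "openin (nabla X) W \<longleftrightarrow>
     W \<subseteq> topspace (box_topology X) // eq_mod_finite (\<lambda>n. topspace (X n))
     \<and> openin (box_topology X) (\<Union>W)"
proof -
  let ?Q = "topspace (box_topology X) // eq_mod_finite (\<lambda>n. topspace (X n))"
  have disj: "\<Union>(S \<inter> T) = \<Union>S \<inter> \<Union>T" if "S \<subseteq> ?Q" "T \<subseteq> ?Q" for S T
  proof
    show "\<Union>S \<inter> \<Union>T \<subseteq> \<Union>(S \<inter> T)"
    proof
      fix x assume "x \<in> \<Union>S \<inter> \<Union>T"
      then obtain P R where "P \<in> S" "R \<in> T" "x \<in> P" "x \<in> R" by blast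
      moreover have "P = R"
        using quotient_disj[OF equiv_eq_mod_finite, of P "\<lambda>n. topspace (X n)" R] that calculation
        by auto
      ultimately show "x \<in> \<Union>(S \<inter> T)" by blast
    qed
  qed blast
  have "istopology (\<lambda>W. W \<subseteq> ?Q \<and> openin (box_topology X) (\<Union>W))"
    unfolding istopology_def
  proof (rule conjI; intro allI impI)
    fix S T
    assume "S \<subseteq> ?Q \<and> openin (box_topology X) (\<Union>S)"
      and "T \<subseteq> ?Q \<and> openin (box_topology X) (\<Union>T)"
    then show "S \<inter> T \<subseteq> ?Q \<and> openin (box_topology X) (\<Union>(S \<inter> T))"
      by (metis disj openin_Int inf.coboundedI1)
  next
    fix K assume K: "\<forall>W\<in>K. W \<subseteq> ?Q \<and> openin (box_topology X) (\<Union>W)"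
    have "\<Union>(\<Union>K) = \<Union>(Union ` K)" by blast
    moreover have "openin (box_topology X) (\<Union>(Union ` K))"
      using K by (intro openin_Union) blast
    ultimately show "\<Union>K \<subseteq> ?Q \<and> openin (box_topology X) (\<Union>(\<Union>K))"
      using K by (metis Union_least)
  qed
  then show ?thesis by (simp add: nabla_def topology_inverse')
qed

lemma topspace_nabla:
  "topspace (nabla X) = topspace (box_topology X) // eq_mod_finite (\<lambda>n. topspace (X n))"
    (is "_ = ?Q")
proof
  show "topspace (nabla X) \<subseteq> ?Q"
    using openin_nabla[of X "topspace (nabla X)"] by simp
  have "\<Union>?Q = topspace (box_topology X)"
    by (simp add: Union_quotient[OF equiv_eq_mod_finite])
  then have "openin (nabla X) ?Q"
    unfolding openin_nabla by (metis openin_topspace order_refl)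
  then show "?Q \<subseteq> topspace (nabla X)" by (rule openin_subset)
qed

lemma quotient_map_nabla:
  "quotient_map (box_topology X) (nabla X) (\<lambda>x. eq_mod_finite (\<lambda>n. topspace (X n)) `` {x})"
proof -
  let ?r = "eq_mod_finite (\<lambda>n. topspace (X n))"
  have eq: "equiv (topspace (box_topology X)) ?r"
    by (simp add: equiv_eq_mod_finite)
  have "{x \<in> topspace (box_topology X). ?r `` {x} \<in> W} = \<Union>W"
    if W: "W \<subseteq> topspace (nabla X)" for W
  proof (intro set_eqI iffI)
    fix x assume "x \<in> {x \<in> topspace (box_topology X). ?r `` {x} \<in> W}"
    then show "x \<in> \<Union>W" using equiv_class_self[OF eq] by blast
  next
    fix x assume "x \<in> \<Union>W"
    then obtain P where P: "P \<in> W" "x \<in> P" by blast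
    then have Q: "P \<in> topspace (box_topology X) // ?r" using W by (auto simp only: topspace_nabla)
    then obtain z where z: "z \<in> topspace (box_topology X)" "P = ?r `` {z}" by (rule quotientE)
    then have "(z, x) \<in> ?r" using P by simp
    then have "?r `` {x} = P" "x \<in> topspace (box_topology X)"
      using equiv_class_eq[OF eq] z by (auto simp: eq_mod_finite_def)
    then show "x \<in> {x \<in> topspace (box_topology X). ?r `` {x} \<in> W}" using P by simp
  qed
  then show ?thesis
    unfolding quotient_map_def
    by (auto simp: openin_nabla topspace_nabla quotient_def simp del: topspace_box_topology)
qed

definition monotonically_normal_space :: "'a topology \<Rightarrow> bool" where
  "monotonically_normal_space T \<longleftrightarrow>
     (\<exists>G. (\<forall>x U. openin T U \<and> x \<in> U \<longrightarrow> openin T (G x U) \<and> x \<in> G x U \<and> G x U \<subseteq> U)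
        \<and> (\<forall>x U y V. openin T U \<and> x \<in> U \<and> openin T V \<and> y \<in> V \<and> G x U \<inter> G y V \<noteq> {}
              \<longrightarrow> x \<in> V \<or> y \<in> U))"

text \<open>Radii are extended reals, so that \<open>1 / 0 = \<infinity>\<close>, in contrast to division on \<^typ>\<open>real\<close>.\<close>

definition recip :: "nat \<Rightarrow> ereal" where
  "recip k = 1 / ereal (real k)"

lemma recip_0 [simp]: "recip 0 = \<infinity>"
  by (simp add: recip_def divide_ereal_def zero_ereal_def[symmetric])

lemma recip_pos: "k > 0 \<Longrightarrow> recip k = ereal (1 / real k)"
  by (simp add: recip_def one_ereal_def)

definition nabla_ball :: "'a metric \<Rightarrow> 'a \<Rightarrow> ereal \<Rightarrow> 'a set" where
  "nabla_ball m a \<epsilon> =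
     (if openin (mtopology_of m) {a} then {a}
      else {b \<in> mspace m. ereal (mdist m a b) < \<epsilon>})"

definition miss_set ::
  "(nat \<Rightarrow> 'a metric) \<Rightarrow> (nat \<Rightarrow> 'a) \<Rightarrow> (nat \<Rightarrow> nat) \<Rightarrow> (nat \<Rightarrow> 'a) \<Rightarrow> nat set" where
  "miss_set m x f y = {n. y n \<notin> nabla_ball (m n) (x n) (recip (f n))}"

definition switch ::
  "(nat \<Rightarrow> 'a metric) \<Rightarrow> (nat \<Rightarrow> 'a) \<times> (nat \<Rightarrow> nat) \<Rightarrow> (nat \<Rightarrow> 'a) \<times> (nat \<Rightarrow> nat) \<Rightarrow> bool" where
  "switch m = (\<lambda>(x, f) (y, g).
     infinite (miss_set m x f y) \<and> infinite (miss_set m y g x)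
     \<and> finite (miss_set m x f y \<inter> miss_set m y g x))"

text \<open>\<open>F\<close> takes equivalence classes, whereas the remaining notions are stated for representatives.
  By \<open>switch_cong\<close> below, the choice of representatives is immaterial.\<close>

definition nabla_Delta :: "(nat \<Rightarrow> 'a metric) \<Rightarrow> bool" where
  "nabla_Delta m \<longleftrightarrow>
     (\<exists>F :: (nat \<Rightarrow> 'a) set \<Rightarrow> (nat \<Rightarrow> nat) \<Rightarrow> (nat \<Rightarrow> nat).
        \<forall>x \<in> Pi\<^sub>E UNIV (\<lambda>n. mspace (m n)). \<forall>y \<in> Pi\<^sub>E UNIV (\<lambda>n. mspace (m n)). \<forall>f g.
          switch m (x, f) (y, g) \<longrightarrow>
          (\<exists>\<^sub>\<infinity>n. recip (F (eq_mod_finite (\<lambda>n. mspace (m n)) `` {x}) f n)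
               + recip (F (eq_mod_finite (\<lambda>n. mspace (m n)) `` {y}) g n)
               < ereal (mdist (m n) (x n) (y n))))"

lemma switch_cong:
  assumes "(x, x') \<in> eq_mod_finite (\<lambda>n. mspace (m n))"
    and "(y, y') \<in> eq_mod_finite (\<lambda>n. mspace (m n))"
  shows "switch m (x, f) (y, g) \<longleftrightarrow> switch m (x', f) (y', g)"
proof -
  let ?E = "{n. x n \<noteq> x' n} \<union> {n. y n \<noteq> y' n}"
  have E: "finite ?E" using assms by (simp add: eq_mod_finite_def)
  have fin: "finite A \<longleftrightarrow> finite B" if "A - ?E = B - ?E" for A B :: "nat set"
    using that E by (metis finite_Diff2)
  have "finite (miss_set m x f y) \<longleftrightarrow> finite (miss_set m x' f y')"
    "finite (miss_set m y g x) \<longleftrightarrow> finite (miss_set m y' g x')"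
    "finite (miss_set m x f y \<inter> miss_set m y g x)
       \<longleftrightarrow> finite (miss_set m x' f y' \<inter> miss_set m y' g x')"
    by (rule fin; auto simp: miss_set_def)+
  then show ?thesis by (simp add: switch_def)
qed

end

theory Submission
  imports Defs
begin

text \<open>Write \<open>N(x,f)\<close> for the set of classes of points \<open>y\<close> with \<open>M(x,f;y)\<close> finite; these sets are a
  base of open neighbourhoods of the class of \<open>x\<close>. Both directions rest on reading
  \<open>y \<notin> N(x,f)\<close> as ``\<open>M(x,f;y)\<close> is infinite''.

  From \<open>\<Delta>\<close> to monotone normality, pick \<open>N(x,f) \<subseteq> U\<close> and let \<open>G(x,U) = N(x, max(2f, f\<^sub>x))\<close>.
  If \<open>G(x,U)\<close> meets \<open>G(y,V)\<close> while \<open>x \<notin> V\<close> and \<open>y \<notin> U\<close>, the factors 2 and the triangle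
  inequality make \<open>M(x,f;y)\<close> and \<open>M(y,g;x)\<close> almost disjoint, so the pairs switch, and
  the bounds \<open>f\<^sub>x\<close> and \<open>g\<^sub>y\<close> contradict \<open>\<Delta>\<close>.

  Conversely, pick \<open>N(x,h) \<subseteq> G(x, N(x,f))\<close> and let \<open>2/f\<^sub>x(n)\<close> be smaller than the distance from
  \<open>x(n)\<close> to the complement of \<open>B\<^sub>n(x(n), 1/h(n))\<close>. If the pairs switch, \<open>N(x,h)\<close> and \<open>N(y,k)\<close>
  are disjoint, so that infinitely often the coordinate balls are disjoint, and there \<open>d\<^sub>n(x(n),y(n))\<close>
  exceeds both \<open>2/f\<^sub>x(n)\<close> and \<open>2/g\<^sub>y(n)\<close>.\<close>

section \<open>Balls and radii in a single metric space\<close>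

lemma openin_mtopology_of_iff:
  "openin (mtopology_of m) U \<longleftrightarrow>
     U \<subseteq> mspace m \<and> (\<forall>a\<in>U. \<exists>r>0. \<forall>b\<in>mspace m. mdist m a b < r \<longrightarrow> b \<in> U)"
proof -
  have "Metric_space.mball (mspace m) (mdist m) a r = {b \<in> mspace m. mdist m a b < r}"
    if "a \<in> mspace m" for a r
    using that Metric_space.in_mball[OF Metric_space_mspace_mdist] by fastforce
  then show ?thesis
    unfolding mtopology_of_def Metric_space.openin_mtopology[OF Metric_space_mspace_mdist]
    by (smt (verit, best) mem_Collect_eq subset_iff)
qed

lemma recip_gt_0: "recip k > 0"
  by (cases "k = 0") (auto simp: recip_pos)

lemma recip_antimono: "j \<le> k \<Longrightarrow> recip k \<le> recip j"
  by (cases "j = 0") (auto simp: recip_pos frac_le)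

lemma ex_recip_less:
  assumes "(r::real) > 0" shows "\<exists>k>0. recip k < ereal r"
proof -
  obtain n where "inverse (real (Suc n)) < r" using reals_Archimedean[OF assms] by blast
  then show ?thesis by (intro exI[of _ "Suc n"]) (simp add: recip_pos divide_inverse)
qed

lemma nabla_ball_subset: "a \<in> mspace m \<Longrightarrow> nabla_ball m a \<epsilon> \<subseteq> mspace m"
  by (auto simp: nabla_ball_def)

lemma mdist_self: "a \<in> mspace m \<Longrightarrow> mdist m a a = 0"
  using Metric_space.mdist_zero[OF Metric_space_mspace_mdist] .

lemma centre_in_nabla_ball: "a \<in> mspace m \<Longrightarrow> \<epsilon> > 0 \<Longrightarrow> a \<in> nabla_ball m a \<epsilon>"
  by (simp add: nabla_ball_def mdist_self zero_ereal_def[symmetric])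

lemma nabla_ball_mono: "\<delta> \<le> \<epsilon> \<Longrightarrow> nabla_ball m a \<delta> \<subseteq> nabla_ball m a \<epsilon>"
  by (auto simp: nabla_ball_def)

text \<open>At an isolated centre \<open>b = a\<close>, and the distance 0 lies below the positive
  \<open>\<epsilon>\<close>. Upper bounds on distances thus avoid a case split on isolation.\<close>

lemma mdist_less_of_nabla_ball:
  assumes "a \<in> mspace m" "\<epsilon> > 0" "b \<in> nabla_ball m a \<epsilon>"
  shows "ereal (mdist m a b) < \<epsilon>"
  using assms by (auto simp: nabla_ball_def mdist_self zero_ereal_def[symmetric] split: if_splits)

lemma openin_nabla_ball:
  assumes a: "a \<in> mspace m"
  shows "openin (mtopology_of m) (nabla_ball m a \<epsilon>)"
proof (cases "openin (mtopology_of m) {a}")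
  case False
  let ?B = "{b \<in> mspace m. ereal (mdist m a b) < \<epsilon>}"
  \<comment> \<open>An infinite \<open>\<epsilon>\<close> makes \<open>?B\<close> the whole space,
    so any radius serves; a finite one leaves the slack \<open>e - mdist m a b\<close>.\<close>
  have "\<exists>r>0. \<forall>c\<in>mspace m. mdist m b c < r \<longrightarrow> c \<in> ?B" if b: "b \<in> ?B" for b
  proof (cases \<epsilon>)
    case (real e)
    with b have "e - mdist m a b > 0" by simp
    moreover have "c \<in> ?B" if "c \<in> mspace m" "mdist m b c < e - mdist m a b" for c
      using that b a real mdist_triangle[of a m b c] by simp
    ultimately show ?thesis by blast
  qed (use b in \<open>auto intro: exI[of _ 1]\<close>)
  then show ?thesis using False by (auto simp: openin_mtopology_of_iff nabla_ball_def)
qed (simp add: nabla_ball_def)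

lemma ex_nabla_ball_subset:
  assumes "openin (mtopology_of m) U" "a \<in> U"
  shows "\<exists>k>0. nabla_ball m a (recip k) \<subseteq> U"
proof -
  obtain r where r: "r > 0" "\<forall>b\<in>mspace m. mdist m a b < r \<longrightarrow> b \<in> U"
    using assms unfolding openin_mtopology_of_iff by blast
  obtain k where k: "k > 0" "recip k < ereal r" using ex_recip_less[OF r(1)] by blast
  have "nabla_ball m a (recip k) \<subseteq> U"
  proof
    fix b assume b: "b \<in> nabla_ball m a (recip k)"
    have a: "a \<in> mspace m" using assms unfolding openin_mtopology_of_iff by blast
    have "mdist m a b < r"
      using mdist_less_of_nabla_ball[OF a recip_gt_0 b] k(2) 
      by (metis less_ereal.simps(1) less_trans)
    then show "b \<in> U" using r b nabla_ball_subset[OF a] by blast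
  qed
  with k show ?thesis by blast
qed

text \<open>The ball is an open neighbourhood of \<open>a\<close>, so points outside it stay at
  least some \<open>r > 0\<close> away from \<open>a\<close>. The factor 2 lets two such bounds, one
  from each of two centres, be averaged.\<close>

lemma ex_mdist_gap:
  assumes "a \<in> mspace m" "\<epsilon> > 0"
  shows "\<exists>k>0. \<forall>b\<in>mspace m - nabla_ball m a \<epsilon>. 2 / real k < mdist m a b"
proof -
  obtain r where r: "r > 0" "\<forall>b\<in>mspace m. mdist m a b < r \<longrightarrow> b \<in> nabla_ball m a \<epsilon>"
    using openin_nabla_ball[OF assms(1)] centre_in_nabla_ball[OF assms]
    unfolding openin_mtopology_of_iff by blast
  obtain k where "k > 0" "recip k < ereal (r / 2)" using ex_recip_less[of "r / 2"] r(1) by auto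
  then have "k > 0" "2 / real k < r" by (auto simp: recip_pos field_simps)
  moreover have "2 / real k < mdist m a b" if "b \<in> mspace m - nabla_ball m a \<epsilon>" for b
    using r(2) that \<open>2 / real k < r\<close> by fastforce
  ultimately show ?thesis by blast
qed

text \<open>If one centre is isolated, its ball is a singleton and \<open>c\<close> is that centre.
  Otherwise the triangle inequality through \<open>c\<close> bounds the distance of the centres by
  the mean of \<open>1/j\<close> and \<open>1/k\<close>, hence by the larger of the two.\<close>

lemma nabla_ball_halves_meet:
  assumes ab: "a \<in> mspace m" "b \<in> mspace m" and pos: "j > 0" "k > 0"
    and c: "c \<in> nabla_ball m a (recip (2 * j))" "c \<in> nabla_ball m b (recip (2 * k))"
  shows "b \<in> nabla_ball m a (recip j) \<or> a \<in> nabla_ball m b (recip k)"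
proof -
  have mono: "nabla_ball m a (recip (2 * j)) \<subseteq> nabla_ball m a (recip j)"
    "nabla_ball m b (recip (2 * k)) \<subseteq> nabla_ball m b (recip k)"
    by (auto intro!: nabla_ball_mono recip_antimono)
  consider "c = a" | "c = b"
    | "\<not> openin (mtopology_of m) {a}" "\<not> openin (mtopology_of m) {b}"
    using c by (auto simp: nabla_ball_def split: if_splits)
  then show ?thesis
  proof cases
    case 3
    have cm: "c \<in> mspace m" using c nabla_ball_subset[OF ab(1)] by blast
    have "mdist m a c < 1 / (2 * real j)" "mdist m b c < 1 / (2 * real k)"
      using mdist_less_of_nabla_ball[OF ab(1) recip_gt_0 c(1)]
        mdist_less_of_nabla_ball[OF ab(2) recip_gt_0 c(2)] pos by (auto simp: recip_pos)
    then have "mdist m a b < (1 / real j + 1 / real k) / 2"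
      using mdist_triangle[of a m c b] ab cm by (simp add: mdist_commute)
    then have "mdist m a b < 1 / real j \<or> mdist m b a < 1 / real k"
      by (auto simp: mdist_commute)
    then show ?thesis using 3 ab pos by (auto simp: nabla_ball_def recip_pos)
  qed (use c mono in blast)+
qed

section \<open>Equivalence classes and basic neighbourhoods in the nabla product\<close>

abbreviation points :: "(nat \<Rightarrow> 'a metric) \<Rightarrow> (nat \<Rightarrow> 'a) set" where
  "points m \<equiv> Pi\<^sub>E UNIV (\<lambda>n. mspace (m n))"

abbreviation cls :: "(nat \<Rightarrow> 'a metric) \<Rightarrow> (nat \<Rightarrow> 'a) \<Rightarrow> (nat \<Rightarrow> 'a) set" where
  "cls m x \<equiv> eq_mod_finite (\<lambda>n. mspace (m n)) `` {x}"

abbreviation nabla_of :: "(nat \<Rightarrow> 'a metric) \<Rightarrow> (nat \<Rightarrow> 'a) set topology" where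
  "nabla_of m \<equiv> nabla (\<lambda>n. mtopology_of (m n))"

lemma topspace_nabla_of: "topspace (nabla_of m) = points m // eq_mod_finite (\<lambda>n. mspace (m n))"
  by (simp add: topspace_nabla)

lemma cls_in_topspace: "x \<in> points m \<Longrightarrow> cls m x \<in> topspace (nabla_of m)"
  unfolding topspace_nabla_of by (rule quotientI)

text \<open>Fixes one representative per class, so that operators on classes can be defined through
  coordinates.\<close>

lemma ex_representatives:
  "\<exists>rep. \<forall>P\<in>topspace (nabla_of m). rep P \<in> points m \<and> cls m (rep P) = P"
  unfolding topspace_nabla_of by (rule bchoice) (auto elim!: quotientE)

lemma cls_eq_iff:
  assumes "x \<in> points m" "y \<in> points m"
  shows "cls m x = cls m y \<longleftrightarrow> (x, y) \<in> eq_mod_finite (\<lambda>n. mspace (m n))"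
  using eq_equiv_class_iff[OF equiv_eq_mod_finite] assms by blast

lemma self_in_cls: "x \<in> points m \<Longrightarrow> x \<in> cls m x"
  by (rule equiv_class_self[OF equiv_eq_mod_finite])

lemma openin_box_topology_iff:
  "openin (box_topology X) W \<longleftrightarrow>
     (\<forall>x\<in>W. \<exists>U. (\<forall>n. openin (X n) (U n)) \<and> x \<in> Pi\<^sub>E UNIV U \<and> Pi\<^sub>E UNIV U \<subseteq> W)"
  unfolding openin_box_topology arbitrary_union_of_alt by metis

text \<open>Changing both points at finitely many coordinates changes the miss set only there.
  Finiteness thus depends on the classes alone.\<close>

lemma finite_miss_set_cong:
  assumes "(x, x') \<in> eq_mod_finite (\<lambda>n. mspace (m n))"
    and "(y, y') \<in> eq_mod_finite (\<lambda>n. mspace (m n))"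
  shows "finite (miss_set m x f y) \<longleftrightarrow> finite (miss_set m x' f y')"
proof -
  let ?E = "{n. x n \<noteq> x' n} \<union> {n. y n \<noteq> y' n}"
  have "finite ?E" using assms by (simp add: eq_mod_finite_def)
  moreover have "miss_set m x f y - ?E = miss_set m x' f y' - ?E"
    by (auto simp: miss_set_def)
  ultimately show ?thesis by (metis finite_Diff2)
qed

text \<open>Larger values of the function mean smaller balls, hence more misses.\<close>

lemma miss_set_mono:
  assumes "\<And>n. f n \<le> g n" shows "miss_set m x f y \<subseteq> miss_set m x g y"
proof
  fix n assume "n \<in> miss_set m x f y"
  then show "n \<in> miss_set m x g y"
    using nabla_ball_mono[OF recip_antimono[OF assms[of n]], of "m n" "x n"]
    by (auto simp: miss_set_def)
qed

text \<open>The set \<open>N(x,f)\<close>, written as an image because points of the space are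
  classes while \<open>miss_set\<close> takes representatives.\<close>

definition nabla_nhd :: "(nat \<Rightarrow> 'a metric) \<Rightarrow> (nat \<Rightarrow> 'a) \<Rightarrow> (nat \<Rightarrow> nat) \<Rightarrow> (nat \<Rightarrow> 'a) set set" where
  "nabla_nhd m x f = cls m ` {y \<in> points m. finite (miss_set m x f y)}"

text \<open>Membership in the image only yields some \<open>z\<close> equivalent to
  \<open>y\<close>; \<open>finite_miss_set_cong\<close> carries finiteness from \<open>z\<close> to
  \<open>y\<close>.\<close>

lemma cls_in_nabla_nhd_iff:
  assumes "x \<in> points m" "y \<in> points m"
  shows "cls m y \<in> nabla_nhd m x f \<longleftrightarrow> finite (miss_set m x f y)"
proof
  assume "cls m y \<in> nabla_nhd m x f"
  then obtain z where z: "z \<in> points m" "finite (miss_set m x f z)" "cls m y = cls m z"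
    by (auto simp: nabla_nhd_def)
  then have "(y, z) \<in> eq_mod_finite (\<lambda>n. mspace (m n))" using cls_eq_iff assms by blast
  moreover have "(x, x) \<in> eq_mod_finite (\<lambda>n. mspace (m n))"
    using assms by (simp add: eq_mod_finite_def)
  ultimately show "finite (miss_set m x f y)" using z finite_miss_set_cong by blast
qed (use assms in \<open>auto simp: nabla_nhd_def\<close>)

text \<open>Openness of a set of classes is tested on its union. The right-hand side is closed under
  finite changes, so taking classes adds no new points.\<close>

lemma Union_nabla_nhd:
  assumes "x \<in> points m"
  shows "\<Union>(nabla_nhd m x f) = {y \<in> points m. finite (miss_set m x f y)}"
proof (intro set_eqI iffI)
  fix y assume "y \<in> \<Union>(nabla_nhd m x f)"
  then obtain z where z: "z \<in> points m" "finite (miss_set m x f z)" "y \<in> cls m z"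
    by (auto simp: nabla_nhd_def)
  then have "(z, y) \<in> eq_mod_finite (\<lambda>n. mspace (m n))" by simp
  moreover have "(x, x) \<in> eq_mod_finite (\<lambda>n. mspace (m n))"
    using assms by (simp add: eq_mod_finite_def)
  ultimately show "y \<in> {y \<in> points m. finite (miss_set m x f y)}"
    using z finite_miss_set_cong[of x x m z y f] by (auto simp: eq_mod_finite_def)
next
  fix y assume "y \<in> {y \<in> points m. finite (miss_set m x f y)}"
  then show "y \<in> \<Union>(nabla_nhd m x f)"
    using self_in_cls[of y m] by (auto simp: nabla_nhd_def)
qed

lemma cls_in_nabla_nhd_self:
  assumes "x \<in> points m" shows "cls m x \<in> nabla_nhd m x f"
proof -
  have "miss_set m x f x = {}"
    using assms by (auto simp: miss_set_def PiE_iff centre_in_nabla_ball recip_gt_0)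
  then show ?thesis using assms cls_in_nabla_nhd_iff by force
qed

lemma openin_nabla_nhd:
  assumes x: "x \<in> points m"
  shows "openin (nabla_of m) (nabla_nhd m x f)"
proof -
  have "nabla_nhd m x f \<subseteq> topspace (nabla_of m)"
    using cls_in_topspace by (auto simp: nabla_nhd_def)
  moreover have "openin (box_topology (\<lambda>n. mtopology_of (m n)))
      {y \<in> points m. finite (miss_set m x f y)}"
    unfolding openin_box_topology_iff
  proof
    fix y assume y: "y \<in> {y \<in> points m. finite (miss_set m x f y)}"
    \<comment> \<open>The factor is the ball where \<open>y\<close> hits it and the whole space
      where \<open>y\<close> misses, so a point of the box can miss only where \<open>y\<close>
      does.\<close>
    define U where "U n = (if n \<in> miss_set m x f y then mspace (m n)
      else nabla_ball (m n) (x n) (recip (f n)))" for n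
    have open_U: "\<forall>n. openin (mtopology_of (m n)) (U n)"
    proof
      fix n show "openin (mtopology_of (m n)) (U n)"
        using x openin_nabla_ball[of "x n" "m n"] openin_topspace[of "mtopology_of (m n)"]
        by (auto simp: U_def PiE_iff)
    qed
    moreover have "y \<in> Pi\<^sub>E UNIV U"
      using y by (auto simp: U_def PiE_iff miss_set_def)
    moreover have "Pi\<^sub>E UNIV U \<subseteq> {y \<in> points m. finite (miss_set m x f y)}"
    proof
      fix z assume z: "z \<in> Pi\<^sub>E UNIV U"
      have "U n \<subseteq> mspace (m n)" for n
        using open_U openin_subset by fastforce
      then have "z \<in> points m" using z by (auto simp: PiE_iff)
      moreover have "n \<in> miss_set m x f y" if "n \<in> miss_set m x f z" for n
      proof (rule ccontr)
        assume "n \<notin> miss_set m x f y"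
        then have "z n \<in> nabla_ball (m n) (x n) (recip (f n))"
          using z by (auto simp: PiE_iff U_def dest!: spec[of _ n])
        then show False using that by (simp add: miss_set_def)
      qed
      ultimately show "z \<in> {y \<in> points m. finite (miss_set m x f y)}"
        using y by (auto intro: finite_subset)
    qed
    ultimately show "\<exists>U. (\<forall>n. openin (mtopology_of (m n)) (U n)) \<and> y \<in> Pi\<^sub>E UNIV U
        \<and> Pi\<^sub>E UNIV U \<subseteq> {y \<in> points m. finite (miss_set m x f y)}" by blast
  qed
  ultimately show ?thesis
    using x unfolding openin_nabla topspace_nabla[symmetric] by (simp add: Union_nabla_nhd)
qed

text \<open>A box inside the union of \<open>W\<close> restricts each coordinate separately, so one
  radius per coordinate suffices; finitely many misses are repaired within the class.\<close>

lemma ex_nabla_nhd_subset: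
  assumes W: "openin (nabla_of m) W" and x: "x \<in> points m" "cls m x \<in> W"
  shows "\<exists>f. (\<forall>n. f n > 0) \<and> nabla_nhd m x f \<subseteq> W"
proof -
  have "x \<in> \<Union>W" using x self_in_cls by blast
  moreover have "openin (box_topology (\<lambda>n. mtopology_of (m n))) (\<Union>W)"
    using W openin_nabla by blast
  ultimately obtain U where U: "\<forall>n. openin (mtopology_of (m n)) (U n)"
      "x \<in> Pi\<^sub>E UNIV U" "Pi\<^sub>E UNIV U \<subseteq> \<Union>W"
    unfolding openin_box_topology_iff by blast
  have "\<exists>k>0. nabla_ball (m n) (x n) (recip k) \<subseteq> U n" for n
    using U by (intro ex_nabla_ball_subset) (auto simp: PiE_iff)
  then obtain f where f: "f n > 0" "nabla_ball (m n) (x n) (recip (f n)) \<subseteq> U n" for n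
    by metis
  have "cls m y \<in> W" if y: "y \<in> points m" "finite (miss_set m x f y)" for y
  proof -
    \<comment> \<open>Replacing the finitely many missed coordinates of \<open>y\<close> by those of
      \<open>x\<close> keeps the class and brings the point into the box.\<close>
    define z where "z n = (if n \<in> miss_set m x f y then x n else y n)" for n
    have "z n \<in> U n" for n
      using U(2) f(2)[of n] by (auto simp: z_def miss_set_def PiE_iff)
    then have "z \<in> Pi\<^sub>E UNIV U" by (simp add: PiE_iff)
    then have "z \<in> \<Union>W" using U(3) by blast
    then obtain P where P: "P \<in> W" "z \<in> P" by blast
    have "z \<in> points m" using x y by (auto simp: z_def PiE_iff)
    moreover have "{n. z n \<noteq> y n} \<subseteq> miss_set m x f y" by (auto simp: z_def)
    ultimately have zy: "(z, y) \<in> eq_mod_finite (\<lambda>n. mspace (m n))"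
      using y by (auto simp: eq_mod_finite_def intro: finite_subset)
    have "P \<in> topspace (nabla_of m)" using P openin_subset[OF W] by blast
    then obtain w where "w \<in> points m" "P = cls m w"
      unfolding topspace_nabla_of by (rule quotientE)
    then have "P = cls m z"
      using P(2) cls_eq_iff[OF _ \<open>z \<in> points m\<close>] by simp
    also have "\<dots> = cls m y" using cls_eq_iff zy \<open>z \<in> points m\<close> y by blast
    finally show ?thesis using P by simp
  qed
  then show ?thesis using f(1) by (auto simp: nabla_nhd_def)
qed

section \<open>Monotone normality from the switching condition\<close>

lemma monotonically_normal_of_nabla_Delta:
  assumes "nabla_Delta m"
  shows "monotonically_normal_space (nabla_of m)"
proof -
  obtain F where "\<forall>x\<in>points m. \<forall>y\<in>points m. \<forall>f g. switch m (x, f) (y, g) \<longrightarrow>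
      (\<exists>\<^sub>\<infinity>n. recip (F (cls m x) f n) + recip (F (cls m y) g n) < ereal (mdist (m n) (x n) (y n)))"
    using assms unfolding nabla_Delta_def by (elim exE) (rule that)
  then have F: "\<exists>\<^sub>\<infinity>n. recip (F (cls m x) f n) + recip (F (cls m y) g n)
      < ereal (mdist (m n) (x n) (y n))"
    if "x \<in> points m" "y \<in> points m" "switch m (x, f) (y, g)" for x y f g
    using that by blast
  obtain rep where rep: "\<forall>P\<in>topspace (nabla_of m). rep P \<in> points m \<and> cls m (rep P) = P"
    by (rule exE[OF ex_representatives])
  define fn where "fn P U = (SOME f. (\<forall>n. f n > 0) \<and> nabla_nhd m (rep P) f \<subseteq> U)" for P U
  have fn: "rep P \<in> points m" "cls m (rep P) = P" "\<And>n. fn P U n > 0" "nabla_nhd m (rep P) (fn P U) \<subseteq> U"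
    if U: "openin (nabla_of m) U" "P \<in> U" for P U
  proof -
    show r: "rep P \<in> points m" "cls m (rep P) = P" using rep U openin_subset by blast+
    have "\<exists>f. (\<forall>n. f n > 0) \<and> nabla_nhd m (rep P) f \<subseteq> U"
      by (rule ex_nabla_nhd_subset[OF U(1) r(1)]) (simp only: r(2) U(2))
    from someI_ex[OF this]
    show "\<And>n. fn P U n > 0" "nabla_nhd m (rep P) (fn P U) \<subseteq> U" by (auto simp: fn_def)
  qed
  \<comment> \<open>The doubled term feeds \<open>nabla_ball_halves_meet\<close>; the other keeps
    the radius below the bound given by \<open>F\<close>. A value 0 of \<open>F\<close> gives an
    infinite bound, which \<open>recip_antimono\<close> also covers.\<close>
  define h where "h P U n = max (2 * fn P U n) (F P (fn P U) n)" for P U n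
  define G where "G P U = nabla_nhd m (rep P) (h P U)" for P U
  have G_nhd: "openin (nabla_of m) (G P U) \<and> P \<in> G P U \<and> G P U \<subseteq> U"
    if U: "openin (nabla_of m) U" "P \<in> U" for P U
  proof -
    note r = fn[OF U]
    have "miss_set m (rep P) (fn P U) y \<subseteq> miss_set m (rep P) (h P U) y" for y
      by (rule miss_set_mono) (simp add: h_def)
    then have "G P U \<subseteq> nabla_nhd m (rep P) (fn P U)"
      unfolding G_def nabla_nhd_def by (intro image_mono Collect_mono) (metis finite_subset)
    moreover have "P \<in> G P U"
      unfolding G_def using cls_in_nabla_nhd_self[OF r(1)] r(2) by metis
    ultimately show ?thesis using r(4) openin_nabla_nhd[OF r(1)] by (auto simp: G_def)
  qed
  have G_disj: "P \<in> V \<or> Q \<in> U"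
    if U: "openin (nabla_of m) U" "P \<in> U" and V: "openin (nabla_of m) V" "Q \<in> V"
      and meet: "G P U \<inter> G Q V \<noteq> {}" for P U Q V
  proof (rule ccontr)
    assume not: "\<not> (P \<in> V \<or> Q \<in> U)"
    define x y f g where "x = rep P" "y = rep Q" "f = fn P U" "g = fn Q V"
    have x: "x \<in> points m" "P = cls m x" "\<And>n. f n > 0" "nabla_nhd m x f \<subseteq> U"
      using fn[OF U] by (simp_all add: x_y_f_g_def)
    have y: "y \<in> points m" "Q = cls m y" "\<And>n. g n > 0" "nabla_nhd m y g \<subseteq> V"
      using fn[OF V] by (simp_all add: x_y_f_g_def)
    have xm: "x n \<in> mspace (m n)" and ym: "y n \<in> mspace (m n)" for n
      using x(1) y(1) by (auto simp: PiE_iff)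
    obtain R where R: "R \<in> G P U" "R \<in> G Q V" using meet by blast
    then obtain z where z: "z \<in> points m" "R = cls m z" by (auto simp: G_def nabla_nhd_def)
    \<comment> \<open>One representative \<open>z\<close> of the common class serves both
      centres.\<close>
    have "finite (miss_set m x (h P U) z)" "finite (miss_set m y (h Q V) z)"
      using R z cls_in_nabla_nhd_iff x(1) y(1) unfolding G_def x_y_f_g_def by blast+
    then have "finite (miss_set m x (h P U) z \<union> miss_set m y (h Q V) z)" by simp
    then have fin: "\<forall>\<^sub>\<infinity>n. z n \<in> nabla_ball (m n) (x n) (recip (h P U n)) \<and>
        z n \<in> nabla_ball (m n) (y n) (recip (h Q V n))"
      unfolding eventually_cofinite miss_set_def by (rule rev_finite_subset) auto
    have "infinite (miss_set m x f y)" "infinite (miss_set m y g x)"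
      using not x y cls_in_nabla_nhd_iff by blast+
    \<comment> \<open>At almost every \<open>n\<close>, the point \<open>z n\<close> lies in both
      balls of half radius, so some centre lies in the ball of the other.\<close>
    moreover have "\<forall>\<^sub>\<infinity>n. \<not> (n \<in> miss_set m x f y \<inter> miss_set m y g x)"
      using fin
    proof eventually_elim
      case (elim n)
      have "recip (h P U n) \<le> recip (2 * f n)" "recip (h Q V n) \<le> recip (2 * g n)"
        by (auto intro!: recip_antimono simp: h_def x_y_f_g_def)
      then have "z n \<in> nabla_ball (m n) (x n) (recip (2 * f n))"
        "z n \<in> nabla_ball (m n) (y n) (recip (2 * g n))"
        using elim by (meson nabla_ball_mono subsetD)+
      then show ?case
        using nabla_ball_halves_meet[OF xm ym x(3) y(3)] by (auto simp: miss_set_def)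
    qed
    ultimately have "switch m (x, f) (y, g)"
      by (simp add: switch_def eventually_cofinite Int_def)
    then have "\<exists>\<^sub>\<infinity>n. recip (F P f n) + recip (F Q g n) < ereal (mdist (m n) (x n) (y n))"
      unfolding x(2) y(2) by (rule F[OF x(1) y(1)])
    \<comment> \<open>The triangle inequality through \<open>z n\<close> gives the opposite
      inequality at almost every coordinate.\<close>
    moreover have "\<forall>\<^sub>\<infinity>n. \<not> (recip (F P f n) + recip (F Q g n) < ereal (mdist (m n) (x n) (y n)))"
      using fin
    proof eventually_elim
      case (elim n)
      have zm: "z n \<in> mspace (m n)" using z by (auto simp: PiE_iff)
      have "ereal (mdist (m n) (x n) (z n)) < recip (h P U n)"
        "ereal (mdist (m n) (y n) (z n)) < recip (h Q V n)"
        using mdist_less_of_nabla_ball[OF xm recip_gt_0] mdist_less_of_nabla_ball[OF ym recip_gt_0]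
          elim by simp_all
      moreover have "recip (h P U n) \<le> recip (F P f n)" "recip (h Q V n) \<le> recip (F Q g n)"
        by (auto intro!: recip_antimono simp: h_def x_y_f_g_def)
      ultimately have "ereal (mdist (m n) (x n) (z n)) + ereal (mdist (m n) (y n) (z n))
          \<le> recip (F P f n) + recip (F Q g n)"
        by (intro add_mono) auto
      moreover have "mdist (m n) (x n) (y n) \<le> mdist (m n) (x n) (z n) + mdist (m n) (y n) (z n)"
        using mdist_triangle[of "x n" "m n" "z n" "y n"] xm ym zm by (simp add: mdist_commute)
      then have "ereal (mdist (m n) (x n) (y n))
          \<le> ereal (mdist (m n) (x n) (z n)) + ereal (mdist (m n) (y n) (z n))"
        by simp
      ultimately show ?case by (meson leD order_trans)
    qed
    ultimately show False unfolding frequently_def by blast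
  qed
  show ?thesis
    unfolding monotonically_normal_space_def
  proof (intro exI[of _ G] conjI[of "All _"] allI impI; elim conjE)
    show "openin (nabla_of m) (G P U) \<and> P \<in> G P U \<and> G P U \<subseteq> U"
      if "openin (nabla_of m) U" "P \<in> U" for P U
      using that by (rule G_nhd)
    show "P \<in> V \<or> Q \<in> U"
      if "openin (nabla_of m) U" "P \<in> U" "openin (nabla_of m) V" "Q \<in> V" "G P U \<inter> G Q V \<noteq> {}"
      for P U Q V
      using that by (rule G_disj)
  qed
qed

section \<open>The switching condition from monotone normality\<close>

lemma nabla_Delta_of_monotonically_normal:
  assumes "monotonically_normal_space (nabla_of m)"
  shows "nabla_Delta m"
proof -
  obtain G where
    G: "\<forall>P U. openin (nabla_of m) U \<and> P \<in> U \<longrightarrow> openin (nabla_of m) (G P U) \<and> P \<in> G P U \<and> G P U \<subseteq> U"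
    and G_disj: "\<forall>P U Q V. openin (nabla_of m) U \<and> P \<in> U \<and> openin (nabla_of m) V \<and> Q \<in> V \<and> G P U \<inter> G Q V \<noteq> {}
      \<longrightarrow> P \<in> V \<or> Q \<in> U"
    using assms unfolding monotonically_normal_space_def by (elim exE conjE) (rule that)
  obtain rep where rep: "\<forall>P\<in>topspace (nabla_of m). rep P \<in> points m \<and> cls m (rep P) = P"
    by (rule exE[OF ex_representatives])
  define h where "h P f = (SOME h. nabla_nhd m (rep P) h \<subseteq> G P (nabla_nhd m (rep P) f))" for P f
  \<comment> \<open>The demand \<open>k > 0\<close> matters: real division gives
    \<open>2 / 0 = 0\<close>, whereas \<open>recip 0\<close> is infinite.\<close>
  define F where "F P f n = (SOME k. k > 0 \<and>
      (\<forall>b\<in>mspace (m n) - nabla_ball (m n) (rep P n) (recip (h P f n)). 2 / real k < mdist (m n) (rep P n) b))"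
    for P f n
  have h: "nabla_nhd m (rep P) (h P f) \<subseteq> G P (nabla_nhd m (rep P) f)"
    if P: "P \<in> topspace (nabla_of m)" for P f
  proof -
    have r: "rep P \<in> points m" "cls m (rep P) = P" using rep P by blast+
    then have "P \<in> nabla_nhd m (rep P) f" using cls_in_nabla_nhd_self by metis
    then have "openin (nabla_of m) (G P (nabla_nhd m (rep P) f))" "P \<in> G P (nabla_nhd m (rep P) f)"
      using G openin_nabla_nhd[OF r(1)] by blast+
    then have "\<exists>h. nabla_nhd m (rep P) h \<subseteq> G P (nabla_nhd m (rep P) f)"
      using ex_nabla_nhd_subset r by metis
    then show ?thesis unfolding h_def by (rule someI_ex)
  qed
  have F: "F P f n > 0 \<and>
      (\<forall>b\<in>mspace (m n) - nabla_ball (m n) (rep P n) (recip (h P f n)).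
        2 / real (F P f n) < mdist (m n) (rep P n) b)"
    if P: "P \<in> topspace (nabla_of m)" for P f n
    unfolding F_def
  proof (rule someI_ex, rule ex_mdist_gap)
    show "rep P n \<in> mspace (m n)" using rep P by (auto simp: PiE_iff)
  qed (rule recip_gt_0)
  have "\<exists>\<^sub>\<infinity>n. recip (F (cls m x) f n) + recip (F (cls m y) g n) < ereal (mdist (m n) (x n) (y n))"
    if x: "x \<in> points m" and y: "y \<in> points m" and sw: "switch m (x, f) (y, g)" for x y f g
  proof -
    define P Q where "P = cls m x" and "Q = cls m y"
    have P: "P \<in> topspace (nabla_of m)" and Q: "Q \<in> topspace (nabla_of m)"
      using x y cls_in_topspace by (auto simp: P_def Q_def)
    \<comment> \<open>\<open>F\<close> sees only classes and is built from their chosen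
      representatives, so the argument passes from \<open>x\<close>, \<open>y\<close> to
      \<open>x'\<close>, \<open>y'\<close>.\<close>
    define x' y' where "x' = rep P" and "y' = rep Q"
    have x': "x' \<in> points m" "P = cls m x'" and y': "y' \<in> points m" "Q = cls m y'"
      using rep P Q by (auto simp: x'_def y'_def)
    have xx': "(x, x') \<in> eq_mod_finite (\<lambda>n. mspace (m n))"
      and yy': "(y, y') \<in> eq_mod_finite (\<lambda>n. mspace (m n))"
      using cls_eq_iff x x' y y' unfolding P_def Q_def by blast+
    have "switch m (x', f) (y', g)" using sw switch_cong[OF xx' yy'] by simp
    then have "Q \<notin> nabla_nhd m x' f" "P \<notin> nabla_nhd m y' g"
      using cls_in_nabla_nhd_iff x' y' by (auto simp: switch_def)
    \<comment> \<open>Each class lies outside the neighbourhood of the other, so monotone normality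
      forbids a common point.\<close>
    then have "G P (nabla_nhd m x' f) \<inter> G Q (nabla_nhd m y' g) = {}"
      using G_disj openin_nabla_nhd cls_in_nabla_nhd_self x' y' by metis
    then have disj: "nabla_nhd m x' (h P f) \<inter> nabla_nhd m y' (h Q g) = {}"
      using h[OF P] h[OF Q] unfolding x'_def y'_def by blast
    let ?B = "\<lambda>n. nabla_ball (m n) (x' n) (recip (h P f n))"
    let ?C = "\<lambda>n. nabla_ball (m n) (y' n) (recip (h Q g n))"
    have xm: "x' n \<in> mspace (m n)" and ym: "y' n \<in> mspace (m n)" for n
      using x'(1) y'(1) by (auto simp: PiE_iff)
    \<comment> \<open>If the balls met at almost every coordinate, selecting common points would
      yield a class in both of the disjoint neighbourhoods.\<close>
    have "\<exists>\<^sub>\<infinity>n. ?B n \<inter> ?C n = {}"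
    proof (rule ccontr)
      assume "\<not> (\<exists>\<^sub>\<infinity>n. ?B n \<inter> ?C n = {})"
      then have fin: "finite {n. ?B n \<inter> ?C n = {}}" by (simp add: INFM_iff_infinite)
      \<comment> \<open>The default \<open>x' n\<close>, taken at finitely many coordinates, only
        keeps \<open>z\<close> in the product.\<close>
      define z where "z n = (if ?B n \<inter> ?C n = {} then x' n else SOME b. b \<in> ?B n \<inter> ?C n)" for n
      have z: "z n \<in> ?B n \<inter> ?C n" if "?B n \<inter> ?C n \<noteq> {}" for n
        using that some_in_eq[of "?B n \<inter> ?C n"] by (simp add: z_def)
      have "z n \<in> mspace (m n)" for n
        using z[of n] xm nabla_ball_subset[OF xm] by (cases "?B n \<inter> ?C n = {}") (auto simp: z_def)
      then have zp: "z \<in> points m" by (auto simp: PiE_iff)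
      have "miss_set m x' (h P f) z \<subseteq> {n. ?B n \<inter> ?C n = {}}"
        "miss_set m y' (h Q g) z \<subseteq> {n. ?B n \<inter> ?C n = {}}"
        using z by (auto simp: miss_set_def)
      then have "cls m z \<in> nabla_nhd m x' (h P f) \<inter> nabla_nhd m y' (h Q g)"
        using fin cls_in_nabla_nhd_iff[OF x'(1) zp] cls_in_nabla_nhd_iff[OF y'(1) zp]
        by (blast intro: finite_subset)
      with disj show False by blast
    qed
    \<comment> \<open>An inequality found infinitely often for \<open>x'\<close>, \<open>y'\<close>
      transfers back to \<open>x\<close>, \<open>y\<close>.\<close>
    moreover have "\<forall>\<^sub>\<infinity>n. x n = x' n \<and> y n = y' n"
      using xx' yy' by (auto simp: eq_mod_finite_def eventually_conj_iff eventually_cofinite)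
    ultimately have "\<exists>\<^sub>\<infinity>n. ?B n \<inter> ?C n = {} \<and> x n = x' n \<and> y n = y' n"
      by (rule INFM_conjI)
    then have "\<exists>\<^sub>\<infinity>n. recip (F P f n) + recip (F Q g n) < ereal (mdist (m n) (x n) (y n))"
    proof (rule INFM_mono)
      fix n assume n: "?B n \<inter> ?C n = {} \<and> x n = x' n \<and> y n = y' n"
      have "x' n \<in> ?B n" "y' n \<in> ?C n"
        using xm ym by (auto intro: centre_in_nabla_ball recip_gt_0)
      \<comment> \<open>Each centre is outside the ball of the other, so both gap bounds apply;
        their average is the claim.\<close>
      then have "y' n \<notin> ?B n" "x' n \<notin> ?C n" using n by blast+
      then have "2 / real (F P f n) < mdist (m n) (x' n) (y' n)"
        "2 / real (F Q g n) < mdist (m n) (y' n) (x' n)"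
        using F[OF P] F[OF Q] xm ym unfolding x'_def y'_def by blast+
      then show "recip (F P f n) + recip (F Q g n) < ereal (mdist (m n) (x n) (y n))"
        using n F[OF P] F[OF Q] by (simp add: recip_pos mdist_commute)
    qed
    then show ?thesis by (simp add: P_def Q_def)
  qed
  then show ?thesis unfolding nabla_Delta_def by blast
qed

theorem proposition37:
  shows "(\<forall>m :: nat \<Rightarrow> 'a metric.
            nabla_Delta m \<longrightarrow> monotonically_normal_space (nabla (\<lambda>n. mtopology_of (m n))))
       \<and> (\<forall>X :: nat \<Rightarrow> 'a topology.
            (\<forall>n. metrizable_space (X n)) \<and> monotonically_normal_space (nabla X) \<longrightarrow>
            (\<forall>m :: nat \<Rightarrow> 'a metric. (\<forall>n. mtopology_of (m n) = X n) \<longrightarrow> nabla_Delta m))"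
proof (intro conjI allI impI)
  fix m :: "nat \<Rightarrow> 'a metric" assume "nabla_Delta m"
  then show "monotonically_normal_space (nabla_of m)"
    by (rule monotonically_normal_of_nabla_Delta)
next
  fix X :: "nat \<Rightarrow> 'a topology" and m :: "nat \<Rightarrow> 'a metric"
  assume X: "(\<forall>n. metrizable_space (X n)) \<and> monotonically_normal_space (nabla X)"
    and m: "\<forall>n. mtopology_of (m n) = X n"
  then have "(\<lambda>n. mtopology_of (m n)) = X" by blast
  with X show "nabla_Delta m" by (intro nabla_Delta_of_monotonically_normal) simp
qed

end
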